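(* Let $G$ be a group acting on a field $L$ by automorphisms, let $K\subseteq L^G$ be a subring, and let $R=K[a_1,\dots,a_n]\subseteq L$ be a finitely generated $G$-stable $K$-subalgebra with $\operatorname{Quot}(R)=L$. Let $E\subseteq L[y_1,\dots,y_n]$ be an extended Derksen ideal with respect to $a_1,\dots,a_n$, let $\mathcal G$ be a reduced Gr\"obner basis of $E$ with respect to an arbitrary monomial ordering, and let $A\subseteq L$ be the $K$-subalgebra generated by the coefficients of all polynomials from $\mathcal G$. Let $\psi\colon K[t_1,\dots,t_r]\to L^G$ be a homomorphism of $K$-algebras, with $K[t_1,\dots,t_r]$ a polynomial ring, whose image contains $A$, and extend $\psi$ to $K[t_1,\dots,t_r,y_1,\dots,y_n]$ by sending each $y_i$ to itself. Choosing preimages under $\psi$ of all coefficients of the polynomials in $\mathcal G$, form a set $\mathcal G_t\subseteq K[t_1,\dots,t_r,y_1,\dots,y_n]$ such that $\psi(\mathcal G_t)=\mathcal G$. Let $b=f(a_1,\dots,a_n)\in R$ with $f\in K[y_1,\dots,y_n]$, let $g\in K[t_1,\dots,t_r,y_1,\dots,y_n]$ be a normal form of $f$ with respect to $\mathcal G_t$, and obtain $g_0\in K[t_1,\dots,t_r]$ by setting all $y_i$ equal to zero in $g$. Then $b\in R^G$ if and only if $b=\psi(g_0)$. In this case, $\psi(g_0)$ expresses $b$ as a polynomial in the invariants $b_i:=\psi(t_i)$.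
   Context: Rings are commutative with identity, and homomorphisms of $K$-algebras fix $K$. $\operatorname{Quot}$ denotes the field of fractions, and $L^G$, $R^G$ denote the subrings of $G$-invariant elements. The $y_i$ are indeterminates on which $G$ acts trivially, so $G$ acts on $L[y_1,\dots,y_n]$ coefficient-wise. The Derksen ideal with respect to $a_1,\dots,a_n$ is $D_{a_1,\dots,a_n}:=\bigcap_{\sigma\in G}(y_1-\sigma\cdot a_1,\dots,y_n-\sigma\cdot a_n)\subseteq L[y_1,\dots,y_n]$. An extended Derksen ideal with respect to $a_1,\dots,a_n$ is a proper, $G$-stable ideal $E\subsetneqq L[y_1,\dots,y_n]$ containing $D_{a_1,\dots,a_n}$. A normal form of a polynomial with respect to a set of polynomials is a result of reducing the polynomial by that set, in the usual sense of Gr\"obner basis theory. *)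

theory Defs
  imports "HOL-Library.Poly_Mapping" "HOL-Algebra.Algebra" "HOL-Algebra.Algebraic_Closure_Type"
begin

text \<open>
  A monomial is a finitely supported exponent vector, written additively, so that
  \<open>u\<close> divides \<open>v\<close> iff \<open>v = u + w\<close> for some \<open>w\<close>. The indeterminates \<open>y\<^sub>1,\<dots>,y\<^sub>n\<close>
  (and likewise \<open>t\<^sub>1,\<dots>,t\<^sub>r\<close>) are numbered by \<open>0,\<dots>,n-1\<close>.
  The ring \<open>K[t\<^sub>1,\<dots>,t\<^sub>r,y\<^sub>1,\<dots>,y\<^sub>n]\<close> is represented as \<open>K[t\<^sub>1,\<dots>,t\<^sub>r][y\<^sub>1,\<dots>,y\<^sub>n]\<close>,
  i.e. as \<open>mpolys (mpolys K r) n\<close>.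
\<close>

type_synonym mono = "nat \<Rightarrow>\<^sub>0 nat"
type_synonym 'c mpoly = "mono \<Rightarrow>\<^sub>0 'c"

definition monomials :: "nat \<Rightarrow> mono set" where
  "monomials n = {m. Poly_Mapping.keys m \<subseteq> {..<n}}"

definition mpolys :: "'c::zero set \<Rightarrow> nat \<Rightarrow> 'c mpoly set" where
  "mpolys C n = {p. Poly_Mapping.keys p \<subseteq> monomials n \<and> (\<forall>m\<in>Poly_Mapping.keys p. Poly_Mapping.lookup p m \<in> C)}"

definition subring_of :: "'c::comm_ring_1 set \<Rightarrow> 'c ring" where
  "subring_of S = ring_of_type_algebra\<lparr>carrier := S\<rparr>"

abbreviation mpoly_ring :: "'c::comm_ring_1 set \<Rightarrow> nat \<Rightarrow> 'c mpoly ring" where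
  "mpoly_ring C n \<equiv> subring_of (mpolys C n)"

definition Const :: "'c::zero \<Rightarrow> 'c mpoly" where
  "Const c = Poly_Mapping.single 0 c"

definition Var :: "nat \<Rightarrow> 'c::zero_neq_one mpoly" where
  "Var i = Poly_Mapping.single (Poly_Mapping.single i 1) 1"

definition eval :: "(nat \<Rightarrow> 'c::comm_semiring_1) \<Rightarrow> 'c mpoly \<Rightarrow> 'c" where
  "eval a p = (\<Sum>m\<in>Poly_Mapping.keys p. Poly_Mapping.lookup p m *
     (\<Prod>i\<in>Poly_Mapping.keys m. a i ^ Poly_Mapping.lookup m i))"

text \<open>Coefficientwise application of a map sending 0 to 0: the action of \<open>G\<close> on
  \<open>L[y]\<close>, the extension of \<open>\<psi>\<close> to \<open>K[t][y]\<close> and the inclusion of \<open>K[y]\<close>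
  in \<open>K[t][y]\<close> are all of this form.\<close>

abbreviation map_coeffs :: "('c::zero \<Rightarrow> 'd::zero) \<Rightarrow> 'c mpoly \<Rightarrow> 'd mpoly" where
  "map_coeffs \<equiv> Poly_Mapping.map"

definition generated_subalgebra :: "'l::comm_ring_1 set \<Rightarrow> 'l set \<Rightarrow> 'l set" where
  "generated_subalgebra K S = generate_ring ring_of_type_algebra (K \<union> S)"

definition quot_is_everything :: "'l::field set \<Rightarrow> bool" where
  "quot_is_everything R \<longleftrightarrow> (\<forall>x. \<exists>p\<in>R. \<exists>q\<in>R. q \<noteq> 0 \<and> x = p / q)"


definition acts_by_automorphisms :: "('g, 'h) monoid_scheme \<Rightarrow> ('g \<Rightarrow> 'l::field \<Rightarrow> 'l) \<Rightarrow> bool" where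
  "acts_by_automorphisms G \<phi> \<longleftrightarrow> group_action G UNIV \<phi> \<and>
     (\<forall>\<sigma>\<in>carrier G. \<phi> \<sigma> \<in> ring_iso ring_of_type_algebra ring_of_type_algebra)"

definition invariants :: "('g, 'h) monoid_scheme \<Rightarrow> ('g \<Rightarrow> 'l \<Rightarrow> 'l) \<Rightarrow> 'l set \<Rightarrow> 'l set" where
  "invariants G \<phi> S = {x\<in>S. \<forall>\<sigma>\<in>carrier G. \<phi> \<sigma> x = x}"

definition stable :: "('g, 'h) monoid_scheme \<Rightarrow> ('g \<Rightarrow> 'x \<Rightarrow> 'x) \<Rightarrow> 'x set \<Rightarrow> bool" where
  "stable G \<phi> S \<longleftrightarrow> (\<forall>\<sigma>\<in>carrier G. \<phi> \<sigma> ` S \<subseteq> S)"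

definition derksen_ideal ::
    "('g, 'h) monoid_scheme \<Rightarrow> ('g \<Rightarrow> 'l::field \<Rightarrow> 'l) \<Rightarrow> nat \<Rightarrow> (nat \<Rightarrow> 'l) \<Rightarrow> 'l mpoly set" where
  "derksen_ideal G \<phi> n a =
     (\<Inter>\<sigma>\<in>carrier G. genideal (mpoly_ring UNIV n) ((\<lambda>i. Var i - Const (\<phi> \<sigma> (a i))) ` {..<n}))"

definition extended_derksen_ideal ::
    "('g, 'h) monoid_scheme \<Rightarrow> ('g \<Rightarrow> 'l::field \<Rightarrow> 'l) \<Rightarrow> nat \<Rightarrow> (nat \<Rightarrow> 'l) \<Rightarrow> 'l mpoly set \<Rightarrow> bool" where
  "extended_derksen_ideal G \<phi> n a E \<longleftrightarrow>
     ideal E (mpoly_ring UNIV n) \<and> E \<noteq> carrier (mpoly_ring UNIV n) \<and>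
     stable G (\<lambda>\<sigma>. map_coeffs (\<phi> \<sigma>)) E \<and> derksen_ideal G \<phi> n a \<subseteq> E"

definition algebra_hom :: "'l::comm_ring_1 set \<Rightarrow> nat \<Rightarrow> 'l set \<Rightarrow> ('l mpoly \<Rightarrow> 'l) \<Rightarrow> bool" where
  "algebra_hom K r S \<psi> \<longleftrightarrow>
     \<psi> \<in> ring_hom (mpoly_ring K r) (subring_of S) \<and> (\<forall>c\<in>K. \<psi> (Const c) = c)"


text \<open>\<open>(u, v) \<in> ord\<close> means \<open>u \<le> v\<close>.\<close>

definition monomial_ordering :: "nat \<Rightarrow> mono rel \<Rightarrow> bool" where
  "monomial_ordering n ord \<longleftrightarrow> linear_order_on (monomials n) ord \<and>
     (\<forall>m\<in>monomials n. (0, m) \<in> ord) \<and>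
     (\<forall>u v. \<forall>w\<in>monomials n. (u, v) \<in> ord \<longrightarrow> (u + w, v + w) \<in> ord)"

text \<open>Leading monomial and leading coefficient, meaningful for nonzero polynomials only.\<close>

definition lm :: "mono rel \<Rightarrow> 'c::zero mpoly \<Rightarrow> mono" where
  "lm ord p = (THE m. m \<in> Poly_Mapping.keys p \<and> (\<forall>m'\<in>Poly_Mapping.keys p. (m', m) \<in> ord))"

definition lc :: "mono rel \<Rightarrow> 'c::zero mpoly \<Rightarrow> 'c" where
  "lc ord p = Poly_Mapping.lookup p (lm ord p)"

definition mono_divides :: "mono \<Rightarrow> mono \<Rightarrow> bool" where
  "mono_divides u v \<longleftrightarrow> (\<exists>w. v = u + w)"

definition leading_ideal :: "nat \<Rightarrow> mono rel \<Rightarrow> 'l::field mpoly set \<Rightarrow> 'l mpoly set" where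
  "leading_ideal n ord S =
     genideal (mpoly_ring UNIV n) ((\<lambda>p. Poly_Mapping.single (lm ord p) 1) ` (S - {0}))"

definition groebner_basis :: "nat \<Rightarrow> mono rel \<Rightarrow> 'l::field mpoly set \<Rightarrow> 'l mpoly set \<Rightarrow> bool" where
  "groebner_basis n ord E B \<longleftrightarrow>
     finite B \<and> B \<subseteq> E \<and> leading_ideal n ord B = leading_ideal n ord E"

definition reduced_groebner_basis ::
    "nat \<Rightarrow> mono rel \<Rightarrow> 'l::field mpoly set \<Rightarrow> 'l mpoly set \<Rightarrow> bool" where
  "reduced_groebner_basis n ord E B \<longleftrightarrow> groebner_basis n ord E B \<and>
     (\<forall>p\<in>B. p \<noteq> 0 \<and> lc ord p = 1 \<and>
        (\<forall>q\<in>B - {p}. \<forall>v\<in>Poly_Mapping.keys p. \<not> mono_divides (lm ord q) v))"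

text \<open>
  Reduction in \<open>K[t][y]\<close> by a set \<open>F\<close>, where \<open>C = K[t]\<close> and \<open>ord\<close> orders the monomials in
  the \<open>y\<^sub>i\<close>. A step subtracts a multiple \<open>q y\<^sup>u h\<close> of some \<open>h \<in> F\<close> such that its leading part
  \<open>(q \<cdot> lc h) y\<^sup>v\<close>, \<open>v = u + lm h\<close>, consists of terms of \<open>p\<close>, which are thereby cancelled.
  This allows both customary ways of reducing: cancelling the whole term
  \<open>(coefficient in K[t]) \<cdot> y\<^sup>v\<close>, and, if \<open>lc h = 1\<close>, cancelling one term
  \<open>(element of K) \<cdot> t\<^sup>w y\<^sup>v\<close> as in \<open>K[t,y]\<close> with a block ordering in which the \<open>y\<^sub>i\<close> dominate.
\<close>

definition reduction_step ::
    "mono rel \<Rightarrow> 'l::comm_ring_1 mpoly set \<Rightarrow> 'l mpoly mpoly set \<Rightarrow> 'l mpoly mpoly \<Rightarrow> 'l mpoly mpoly \<Rightarrow> bool" where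
  "reduction_step ord C F p p' \<longleftrightarrow>
     (\<exists>h\<in>F - {0}. \<exists>q\<in>C. \<exists>u.
        q * lc ord h \<noteq> 0 \<and>
        (\<forall>w\<in>Poly_Mapping.keys (q * lc ord h).
           Poly_Mapping.lookup (q * lc ord h) w =
           Poly_Mapping.lookup (Poly_Mapping.lookup p (u + lm ord h)) w) \<and>
        p' = p - Poly_Mapping.single u q * h)"

definition normal_form ::
    "mono rel \<Rightarrow> 'l::comm_ring_1 mpoly set \<Rightarrow> 'l mpoly mpoly set \<Rightarrow> 'l mpoly mpoly \<Rightarrow> 'l mpoly mpoly \<Rightarrow> bool" where
  "normal_form ord C F p g \<longleftrightarrow> (reduction_step ord C F)\<^sup>*\<^sup>* p g \<and>
     (\<forall>v\<in>Poly_Mapping.keys g. \<forall>h\<in>F - {0}. \<not> mono_divides (lm ord h) v)"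

text \<open>
  \<open>Bt\<close> arises from \<open>B\<close> by replacing coefficients with preimages under \<open>\<psi>\<close>. Only the
  coefficients that actually occur, i.e. the nonzero ones, are lifted: hence the condition
  that \<open>h\<close> and its image involve the same monomials in the \<open>y\<^sub>i\<close>. Nothing is assumed about
  which preimages are chosen; in particular 1 need not be lifted to 1.
\<close>

definition coefficient_lift ::
    "'l::comm_ring_1 set \<Rightarrow> nat \<Rightarrow> nat \<Rightarrow> ('l mpoly \<Rightarrow> 'l) \<Rightarrow> 'l mpoly set \<Rightarrow> 'l mpoly mpoly set \<Rightarrow> bool" where
  "coefficient_lift K r n \<psi> B Bt \<longleftrightarrow>
     Bt \<subseteq> mpolys (mpolys K r) n \<and> map_coeffs \<psi> ` Bt = B \<and>
     (\<forall>h\<in>Bt. Poly_Mapping.keys (map_coeffs \<psi> h) = Poly_Mapping.keys h)"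

end

theory Submission
  imports Defs
begin

text \<open>
  Suppose that \<open>b = f(a)\<close> is invariant. For every \<open>\<sigma>\<close> the coefficients of \<open>f\<close> are fixed by
  \<open>\<sigma>\<close>, so \<open>f(\<sigma> a) = \<sigma> b = b\<close>, and therefore \<open>f - b\<close> vanishes at the point \<open>\<sigma> a\<close>, i.e. it
  lies in the ideal \<open>(y\<^sub>i - \<sigma> a\<^sub>i)\<^sub>i\<close>. Hence \<open>f - b\<close> lies in the Derksen ideal and thus in \<open>E\<close>
  (\<open>diff_Const_invariant_in_derksen_ideal\<close>).

  A reduction step subtracts a multiple of some element of the lifted basis, and \<open>\<psi>\<close> sends this
  multiple into \<open>E\<close>; so \<open>f\<close> and \<open>\<psi>(g)\<close> are congruent modulo \<open>E\<close> (\<open>reduction_preserves\<close>).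
  Consequently \<open>\<psi>(g)\<close> and the constant \<open>b\<close> are congruent modulo \<open>E\<close>. No leading monomial of the
  Groebner basis divides a monomial of \<open>\<psi>(g)\<close>, because the lift keeps the monomials of each
  basis element and hence its leading monomial. None of them divides \<open>1\<close> either, since \<open>E\<close> is
  proper. By uniqueness of normal forms \<open>\<psi>(g) = b\<close> (\<open>standard_congruent_const\<close>), and comparing
  constant coefficients gives \<open>\<psi>(g\<^sub>0) = b\<close>.

  The converse is immediate: \<open>\<psi>\<close> takes invariant values, and \<open>b = f(a)\<close> lies in \<open>R\<close>. That
  \<open>\<psi>(g\<^sub>0)\<close> is a polynomial expression in the \<open>\<psi>(t\<^sub>i)\<close> holds because an algebra homomorphism on
  a polynomial ring is the evaluation at the images of the variables (\<open>algebra_hom_eq_eval\<close>).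
\<close>

section \<open>Subrings and ideals of a ring given by a type class\<close>

lemma ring_of_type_algebra_simps [simp]:
  "carrier (ring_of_type_algebra :: 'a::comm_ring_1 ring) = UNIV"
  "x \<otimes>\<^bsub>(ring_of_type_algebra :: 'a ring)\<^esub> y = x * y"
  "x \<oplus>\<^bsub>(ring_of_type_algebra :: 'a ring)\<^esub> y = x + y"
  "\<zero>\<^bsub>(ring_of_type_algebra :: 'a ring)\<^esub> = 0"
  "\<one>\<^bsub>(ring_of_type_algebra :: 'a ring)\<^esub> = 1"
  by (simp_all add: ring_of_type_algebra_def)

lemma ring_of_type_algebra_a_inv [simp]:
  "\<ominus>\<^bsub>(ring_of_type_algebra :: 'a::comm_ring_1 ring)\<^esub> x = - x"
proof -
  interpret ring "ring_of_type_algebra :: 'a ring" ..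
  show ?thesis
    using minus_equality[of "- x" x] by simp
qed

lemma subring_of_simps [simp]:
  "carrier (subring_of S) = S"
  "x \<otimes>\<^bsub>subring_of S\<^esub> y = x * y"
  "x \<oplus>\<^bsub>subring_of S\<^esub> y = x + y"
  "\<zero>\<^bsub>subring_of S\<^esub> = 0"
  "\<one>\<^bsub>subring_of S\<^esub> = 1"
  by (simp_all add: subring_of_def)

context
  fixes S :: "'a::comm_ring_1 set"
  assumes S: "subring S ring_of_type_algebra"
begin

lemma subring_zero: "0 \<in> S"
  and subring_one: "1 \<in> S"
  and subring_uminus: "x \<in> S \<Longrightarrow> - x \<in> S"
  and subring_mult: "x \<in> S \<Longrightarrow> y \<in> S \<Longrightarrow> x * y \<in> S"
  and subring_add: "x \<in> S \<Longrightarrow> y \<in> S \<Longrightarrow> x + y \<in> S"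
  using subringE[OF S] by simp_all

lemma subring_minus: "x \<in> S \<Longrightarrow> y \<in> S \<Longrightarrow> x - y \<in> S"
  using subring_add[of x "- y"] subring_uminus[of y] by simp

lemma subring_power: "x \<in> S \<Longrightarrow> x ^ k \<in> S"
  by (induction k) (auto intro: subring_one subring_mult)

lemma subring_sum: "(\<And>i. i \<in> I \<Longrightarrow> x i \<in> S) \<Longrightarrow> sum x I \<in> S"
  by (induction I rule: infinite_finite_induct) (auto intro: subring_zero subring_add)

lemma subring_prod: "(\<And>i. i \<in> I \<Longrightarrow> x i \<in> S) \<Longrightarrow> prod x I \<in> S"
  by (induction I rule: infinite_finite_induct) (auto intro: subring_one subring_mult)

lemma ring_subring_of: "ring (subring_of S)"
  unfolding subring_of_def
  using ring.subring_is_ring[OF ring_from_type_algebra S] .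

end

lemma subring_of_type_algebraI:
  fixes S :: "'a::comm_ring_1 set"
  assumes "1 \<in> S"
    and "\<And>x. x \<in> S \<Longrightarrow> - x \<in> S"
    and "\<And>x y. x \<in> S \<Longrightarrow> y \<in> S \<Longrightarrow> x * y \<in> S"
    and "\<And>x y. x \<in> S \<Longrightarrow> y \<in> S \<Longrightarrow> x + y \<in> S"
  shows "subring S ring_of_type_algebra"
  by (rule ring.subringI[OF ring_from_type_algebra]) (use assms in simp_all)

lemma subring_UNIV: "subring (UNIV :: 'a::comm_ring_1 set) ring_of_type_algebra"
  by (rule subring_of_type_algebraI) auto

context
  fixes S I :: "'a::comm_ring_1 set"
  assumes I: "ideal I (subring_of S)"
begin

lemma ideal_zero: "0 \<in> I"
  and ideal_add: "x \<in> I \<Longrightarrow> y \<in> I \<Longrightarrow> x + y \<in> I"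
  and ideal_mult: "s \<in> S \<Longrightarrow> x \<in> I \<Longrightarrow> s * x \<in> I"
  using additive_subgroup.zero_closed[OF ideal.axioms(1)[OF I]]
    additive_subgroup.a_closed[OF ideal.axioms(1)[OF I]] ideal.I_l_closed[OF I]
  by simp_all

lemma ideal_uminus:
  assumes "subring S ring_of_type_algebra" "x \<in> I"
  shows "- x \<in> I"
  using ideal_mult[OF subring_uminus[OF assms(1) subring_one[OF assms(1)]] assms(2)] by simp

lemma ideal_sum: "(\<And>i. i \<in> A \<Longrightarrow> x i \<in> I) \<Longrightarrow> sum x A \<in> I"
  by (induction A rule: infinite_finite_induct) (auto intro: ideal_zero ideal_add)

end

lemma ideal_subring_ofI:
  fixes S I :: "'a::comm_ring_1 set"
  assumes S: "subring S ring_of_type_algebra" and "I \<subseteq> S" "0 \<in> I"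
    and "\<And>x y. x \<in> I \<Longrightarrow> y \<in> I \<Longrightarrow> x + y \<in> I"
    and mult: "\<And>s x. s \<in> S \<Longrightarrow> x \<in> I \<Longrightarrow> s * x \<in> I"
  shows "ideal I (subring_of S)"
proof (rule idealI)
  interpret ring "subring_of S" by (rule ring_subring_of[OF S])
  show "ring (subring_of S)" ..
  have "\<ominus>\<^bsub>subring_of S\<^esub> x = - x" if "x \<in> S" for x
    using minus_equality[of "- x" x] that subring_uminus[OF S, of x] by simp
  moreover have "- x \<in> I" if "x \<in> I" for x
    using mult[OF subring_uminus[OF S subring_one[OF S]] that] by simp
  ultimately show "subgroup I (add_monoid (subring_of S))"
    using assms(2-4) by (intro add.subgroupI) (auto simp flip: a_inv_def)
  show "s \<otimes>\<^bsub>subring_of S\<^esub> x \<in> I" "x \<otimes>\<^bsub>subring_of S\<^esub> s \<in> I"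
    if "x \<in> I" "s \<in> carrier (subring_of S)" for x s
    using mult[of s x] that by (simp_all add: mult.commute)
qed

context
  fixes h :: "'a::comm_ring_1 \<Rightarrow> 'b::comm_ring_1" and S :: "'a set" and T :: "'b set"
  assumes h: "h \<in> ring_hom (subring_of S) (subring_of T)"
    and S: "subring S ring_of_type_algebra"
begin

lemma hom_closed: "x \<in> S \<Longrightarrow> h x \<in> T"
  and hom_mult: "x \<in> S \<Longrightarrow> y \<in> S \<Longrightarrow> h (x * y) = h x * h y"
  and hom_add: "x \<in> S \<Longrightarrow> y \<in> S \<Longrightarrow> h (x + y) = h x + h y"
  and hom_one: "h 1 = 1"
  using ring_hom_memE[OF h] by simp_all

lemma hom_zero: "h 0 = 0"
  using hom_add[OF subring_zero[OF S] subring_zero[OF S]] by simp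

lemma hom_minus: "x \<in> S \<Longrightarrow> y \<in> S \<Longrightarrow> h (x - y) = h x - h y"
  using hom_add[OF subring_minus[OF S, of x y], of y] by simp

lemma hom_sum: "(\<And>i. i \<in> I \<Longrightarrow> x i \<in> S) \<Longrightarrow> h (sum x I) = (\<Sum>i\<in>I. h (x i))"
  by (induction I rule: infinite_finite_induct)
    (simp_all add: hom_zero hom_add subring_sum[OF S])

lemma hom_power: "x \<in> S \<Longrightarrow> h (x ^ k) = h x ^ k"
  by (induction k) (simp_all add: hom_one hom_mult subring_power[OF S])

lemma hom_prod: "(\<And>i. i \<in> I \<Longrightarrow> x i \<in> S) \<Longrightarrow> h (prod x I) = (\<Prod>i\<in>I. h (x i))"
  by (induction I rule: infinite_finite_induct)
    (simp_all add: hom_one hom_mult subring_prod[OF S])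

end

section \<open>Polynomial rings\<close>

lemma mpolysD: "p \<in> mpolys C n \<Longrightarrow> m \<in> Poly_Mapping.keys p \<Longrightarrow> m \<in> monomials n"
  and mpolysD_coeff: "p \<in> mpolys C n \<Longrightarrow> 0 \<in> C \<Longrightarrow> Poly_Mapping.lookup p m \<in> C"
  unfolding mpolys_def by (auto simp: in_keys_iff)

lemma mpolysI:
  "(\<And>m. m \<in> Poly_Mapping.keys p \<Longrightarrow> m \<in> monomials n \<and> Poly_Mapping.lookup p m \<in> C) \<Longrightarrow> p \<in> mpolys C n"
  by (auto simp: mpolys_def)

lemma mpolys_mono: "C \<subseteq> D \<Longrightarrow> mpolys C n \<subseteq> mpolys D n"
  by (auto simp: mpolys_def)

lemma monomials_zero: "0 \<in> monomials n"
  and monomials_add: "u \<in> monomials n \<Longrightarrow> v \<in> monomials n \<Longrightarrow> u + v \<in> monomials n"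
  using keys_add[of u v] by (auto simp: monomials_def)

text \<open>
  A reduction step may use any exponent vector \<open>u\<close>; this shows that \<open>u\<close> is nevertheless a
  monomial in the first \<open>n\<close> variables, since its sum with a leading monomial occurs in the
  polynomial being reduced.
\<close>

lemma monomials_add_left: "u + v \<in> monomials n \<Longrightarrow> u \<in> monomials n"
  by (auto simp: monomials_def in_keys_iff lookup_add subset_iff)

lemma sum_singles: "(\<Sum>k\<in>Poly_Mapping.keys p. Poly_Mapping.single k (Poly_Mapping.lookup p k)) = p"
  by (rule poly_mapping_eqI)
    (simp add: lookup_sum lookup_single when_def sum.delta in_keys_iff)

lemma lookup_single_times:
  fixes p :: "'c::comm_ring_1 mpoly"
  shows "Poly_Mapping.lookup (Poly_Mapping.single u q * p) (u + w) = q * Poly_Mapping.lookup p w"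
proof -
  have "Poly_Mapping.lookup (Poly_Mapping.single u q * p) (u + w) =
      (\<Sum>m\<in>Poly_Mapping.keys p. Poly_Mapping.lookup
        (Poly_Mapping.single (u + m) (q * Poly_Mapping.lookup p m)) (u + w))"
    by (subst sum_singles[of p, symmetric])
      (simp add: sum_distrib_left mult_single lookup_sum)
  also have "\<dots> = q * Poly_Mapping.lookup p w"
    by (simp add: lookup_single when_def sum.delta in_keys_iff)
  finally show ?thesis .
qed

lemma keys_single_times:
  fixes p :: "'c::comm_ring_1 mpoly"
  shows "Poly_Mapping.keys (Poly_Mapping.single u q * p) \<subseteq> (+) u ` Poly_Mapping.keys p"
  using keys_mult[of "Poly_Mapping.single u q" p] by (auto split: if_splits)

lemma lookup_single_times_eq_0:
  fixes p :: "'c::comm_ring_1 mpoly"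
  shows "\<not> mono_divides u v \<Longrightarrow> Poly_Mapping.lookup (Poly_Mapping.single u q * p) v = 0"
  using keys_single_times[of u q p] by (auto simp: mono_divides_def in_keys_iff)

lemma subring_mpolys:
  fixes C :: "'c::comm_ring_1 set"
  assumes C: "subring C ring_of_type_algebra"
  shows "subring (mpolys C n) ring_of_type_algebra"
proof (rule subring_of_type_algebraI)
  note coeff = mpolysD_coeff[OF _ subring_zero[OF C]]
  show "1 \<in> mpolys C n"
    by (auto simp: monomials_zero subring_one[OF C] intro: mpolysI)
  show "- p \<in> mpolys C n" if "p \<in> mpolys C n" for p
    using that coeff[OF that]
    by (auto intro!: mpolysI subring_uminus[OF C] mpolysD[OF that] simp: in_keys_iff)
  show add: "p + q \<in> mpolys C n" if "p \<in> mpolys C n" "q \<in> mpolys C n" for p q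
    using keys_add[of p q] coeff[OF that(1)] coeff[OF that(2)]
    by (auto intro!: mpolysI subring_add[OF C] dest: mpolysD[OF that(1)] mpolysD[OF that(2)]
        simp: lookup_add)
  show "p * q \<in> mpolys C n" if p: "p \<in> mpolys C n" and q: "q \<in> mpolys C n" for p q
  proof -
    have term_closed: "Poly_Mapping.single m (Poly_Mapping.lookup p m) * q \<in> mpolys C n"
      if m: "m \<in> Poly_Mapping.keys p" for m
    proof (rule mpolysI)
      fix v assume "v \<in> Poly_Mapping.keys (Poly_Mapping.single m (Poly_Mapping.lookup p m) * q)"
      then obtain w where w: "w \<in> Poly_Mapping.keys q" "v = m + w"
        using keys_single_times by blast
      then show "v \<in> monomials n \<and>
          Poly_Mapping.lookup (Poly_Mapping.single m (Poly_Mapping.lookup p m) * q) v \<in> C"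
        using mpolysD[OF p m] mpolysD[OF q w(1)]
        using coeff[OF p] coeff[OF q]
        by (simp add: monomials_add lookup_single_times subring_mult[OF C])
    qed
    have "(\<Sum>m\<in>M. Poly_Mapping.single m (Poly_Mapping.lookup p m) * q) \<in> mpolys C n"
      if "finite M" "M \<subseteq> Poly_Mapping.keys p" for M
      using that
    proof (induction M)
      case empty
      then show ?case by (simp add: mpolys_def)
    next
      case (insert m M)
      then show ?case by (simp add: add term_closed)
    qed
    then have "(\<Sum>m\<in>Poly_Mapping.keys p. Poly_Mapping.single m (Poly_Mapping.lookup p m)) * q
        \<in> mpolys C n"
      by (simp add: sum_distrib_right)
    then show ?thesis
      by (simp add: sum_singles)
  qed
qed

lemma Const_in_mpolys: "c \<in> C \<Longrightarrow> Const c \<in> mpolys C n"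
  by (rule mpolysI) (auto simp: Const_def monomials_zero split: if_splits)

lemma Var_in_mpolys: "1 \<in> C \<Longrightarrow> i < n \<Longrightarrow> Var i \<in> mpolys C n"
  by (rule mpolysI) (auto simp: Var_def monomials_def split: if_splits)

lemma Const_hom: "Const \<in> ring_hom (subring_of (UNIV :: 'c::comm_ring_1 set)) (subring_of UNIV)"
  by (rule ring_hom_memI) (simp_all add: Const_def mult_single single_add)

lemma Const_zero [simp]: "Const 0 = 0"
  by (simp add: Const_def)

lemma lookup_map_coeffs:
  "h 0 = 0 \<Longrightarrow> Poly_Mapping.lookup (map_coeffs h p) m = h (Poly_Mapping.lookup p m)"
  by (simp add: Poly_Mapping.map.rep_eq when_def)

lemma map_coeffs_map_coeffs:
  assumes "h 0 = 0" "k 0 = 0"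
  shows "map_coeffs h (map_coeffs k p) = map_coeffs (\<lambda>c. h (k c)) p"
  by (rule poly_mapping_eqI) (simp add: lookup_map_coeffs assms)

lemma map_coeffs_ident:
  assumes "\<And>m. m \<in> Poly_Mapping.keys p \<Longrightarrow> h (Poly_Mapping.lookup p m) = Poly_Mapping.lookup p m"
  shows "map_coeffs h p = p"
  by (rule poly_mapping_eqI) (use assms in \<open>auto simp: Poly_Mapping.map.rep_eq when_def in_keys_iff\<close>)

lemma keys_map_coeffs: "Poly_Mapping.keys (map_coeffs h p) \<subseteq> Poly_Mapping.keys p"
  by (auto simp: in_keys_iff Poly_Mapping.map.rep_eq)

lemma map_coeffs_in_mpolys:
  assumes "p \<in> mpolys C n" "\<And>c. c \<in> C \<Longrightarrow> h c \<in> D"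
  shows "map_coeffs h p \<in> mpolys D n"
  using assms keys_map_coeffs[of h p]
  by (auto simp: mpolys_def Poly_Mapping.map.rep_eq when_def in_keys_iff subset_iff)

context
  fixes h :: "'c::comm_ring_1 \<Rightarrow> 'd::comm_ring_1" and C D
  assumes h: "h \<in> ring_hom (subring_of C) (subring_of D)"
    and C: "subring C ring_of_type_algebra"
begin

lemma map_coeffs_minus:
  assumes "p \<in> mpolys C n" "q \<in> mpolys C n"
  shows "map_coeffs h (p - q) = map_coeffs h p - map_coeffs h q"
  using mpolysD_coeff[OF assms(1) subring_zero[OF C]] mpolysD_coeff[OF assms(2) subring_zero[OF C]]
  by (intro poly_mapping_eqI)
    (simp add: lookup_map_coeffs hom_zero[OF h C] hom_minus[OF h C] lookup_minus)

lemma map_coeffs_single_times: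
  assumes q: "q \<in> C" and p: "p \<in> mpolys C n"
  shows "map_coeffs h (Poly_Mapping.single u q * p) = Poly_Mapping.single u (h q) * map_coeffs h p"
proof (rule poly_mapping_eqI)
  fix v
  show "Poly_Mapping.lookup (map_coeffs h (Poly_Mapping.single u q * p)) v =
      Poly_Mapping.lookup (Poly_Mapping.single u (h q) * map_coeffs h p) v"
  proof (cases "mono_divides u v")
    case True
    then show ?thesis
      using q mpolysD_coeff[OF p subring_zero[OF C]]
      by (auto simp: mono_divides_def lookup_map_coeffs hom_zero[OF h C] lookup_single_times
          hom_mult[OF h C])
  next
    case False
    then show ?thesis
      by (simp add: lookup_map_coeffs hom_zero[OF h C] lookup_single_times_eq_0)
  qed
qed

end

section \<open>Evaluation\<close>

lemma eval_superset:
  assumes "finite M" "Poly_Mapping.keys p \<subseteq> M"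
  shows "eval a p = (\<Sum>m\<in>M. Poly_Mapping.lookup p m *
    (\<Prod>i\<in>Poly_Mapping.keys m. a i ^ Poly_Mapping.lookup m i))"
  unfolding eval_def using assms by (intro sum.mono_neutral_left) (auto simp: in_keys_iff)

lemma eval_in_subring:
  fixes a :: "nat \<Rightarrow> 'c::comm_ring_1"
  assumes S: "subring S ring_of_type_algebra" and p: "p \<in> mpolys S n"
    and a: "\<And>i. i < n \<Longrightarrow> a i \<in> S"
  shows "eval a p \<in> S"
  unfolding eval_def
  by (intro subring_sum[OF S] subring_mult[OF S] subring_prod[OF S] subring_power[OF S] a
      mpolysD_coeff[OF p subring_zero[OF S]])
    (use mpolysD[OF p] in \<open>auto simp: monomials_def\<close>)

text \<open>
  Three instances of this lemma are used: \<open>h = \<sigma>\<close> turns \<open>\<sigma>(f(a))\<close> into \<open>f(\<sigma> a)\<close>, \<open>h = \<psi>\<close>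
  yields the universal property of polynomial rings, and \<open>h = Const\<close> exhibits a value of a
  polynomial as the value of that polynomial at a point with constant coordinates.
\<close>

lemma hom_eval:
  fixes h :: "'c::comm_ring_1 \<Rightarrow> 'd::comm_ring_1"
  assumes h: "h \<in> ring_hom (subring_of S) (subring_of T)"
    and S: "subring S ring_of_type_algebra"
    and p: "p \<in> mpolys S n" and a: "\<And>i. i < n \<Longrightarrow> a i \<in> S"
  shows "h (eval a p) = eval (\<lambda>i. h (a i)) (map_coeffs h p)"
proof -
  have a': "a i \<in> S" if "m \<in> Poly_Mapping.keys p" "i \<in> Poly_Mapping.keys m" for m i
    using mpolysD[OF p that(1)] that(2) a by (auto simp: monomials_def)
  have c: "Poly_Mapping.lookup p m \<in> S" for m
    using mpolysD_coeff[OF p subring_zero[OF S]] .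
  have "h (eval a p) = (\<Sum>m\<in>Poly_Mapping.keys p. h (Poly_Mapping.lookup p m) *
      (\<Prod>i\<in>Poly_Mapping.keys m. h (a i) ^ Poly_Mapping.lookup m i))"
    unfolding eval_def
    by (simp add: hom_sum[OF h S] hom_mult[OF h S] hom_prod[OF h S] hom_power[OF h S]
        subring_mult[OF S] subring_prod[OF S] subring_power[OF S] a' c)
  then show ?thesis
    by (simp add: eval_superset[OF finite_keys keys_map_coeffs]
        lookup_map_coeffs hom_zero[OF h S])
qed

text \<open>
  Every polynomial is its own value at the point whose coordinates are the variables. Statements
  about arbitrary polynomials thereby become statements about evaluation.
\<close>

lemma eval_Var:
  fixes p :: "'a::comm_ring_1 mpoly"
  shows "eval Var (map_coeffs Const p) = p"
proof -
  have power: "Var i ^ k = (Poly_Mapping.single (Poly_Mapping.single i k) 1 :: 'a mpoly)" for i k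
    by (induction k) (simp_all add: Var_def mult_single flip: single_add)
  have "(\<Prod>i\<in>I. Poly_Mapping.single (e i) 1) = (Poly_Mapping.single (sum e I) 1 :: 'a mpoly)"
    for e :: "nat \<Rightarrow> mono" and I
    by (induction I rule: infinite_finite_induct) (simp_all add: mult_single)
  then have "Const c * (\<Prod>i\<in>Poly_Mapping.keys m. Var i ^ Poly_Mapping.lookup m i) =
      (Poly_Mapping.single m c :: 'a mpoly)" for m c
    by (simp add: power sum_singles Const_def mult_single)
  then show ?thesis
    by (simp add: eval_superset[OF finite_keys keys_map_coeffs] lookup_map_coeffs sum_singles)
qed

lemma eval_zero_point:
  fixes p :: "'a::comm_ring_1 mpoly"
  shows "eval (\<lambda>_. 0) p = Poly_Mapping.lookup p 0"
proof -
  have "(\<Prod>i\<in>Poly_Mapping.keys m. 0 ^ Poly_Mapping.lookup m i) = (if m = 0 then 1 else 0 :: 'a)"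
    for m :: mono
  proof (cases "m = 0")
    case False
    then obtain i where "i \<in> Poly_Mapping.keys m"
      by (metis lookup_zero poly_mapping_eqI in_keys_iff)
    then have "0 ^ Poly_Mapping.lookup m i = (0 :: 'a)"
      by (simp add: in_keys_iff zero_power)
    with \<open>i \<in> Poly_Mapping.keys m\<close> have
      "(\<Prod>i\<in>Poly_Mapping.keys m. 0 ^ Poly_Mapping.lookup m i) = (0 :: 'a)"
      by (intro prod_zero) auto
    with False show ?thesis by simp
  qed simp
  then have "eval (\<lambda>_. 0) p =
      (\<Sum>m\<in>Poly_Mapping.keys p. if m = 0 then Poly_Mapping.lookup p m else 0)"
    unfolding eval_def by (intro sum.cong) simp_all
  then show ?thesis
    by (simp add: sum.delta in_keys_iff)
qed

lemma prod_diff_in_ideal: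
  fixes x y :: "'i \<Rightarrow> 'c::comm_ring_1"
  assumes I: "ideal I (subring_of S)" and S: "subring S ring_of_type_algebra"
    and "\<And>i. i \<in> A \<Longrightarrow> x i \<in> S" "\<And>i. i \<in> A \<Longrightarrow> y i \<in> S" "\<And>i. i \<in> A \<Longrightarrow> x i - y i \<in> I"
  shows "prod x A - prod y A \<in> I"
  using assms(3-)
proof (induction A rule: infinite_finite_induct)
  case (insert i A)
  have "prod x (insert i A) - prod y (insert i A) =
      x i * (prod x A - prod y A) + prod y A * (x i - y i)"
    using insert.hyps by (simp add: algebra_simps)
  also have "\<dots> \<in> I"
    using insert by (intro ideal_add[OF I] ideal_mult[OF I] subring_prod[OF S]) auto
  finally show ?case .
qed (use ideal_zero[OF I] in simp_all)

lemma power_diff_in_ideal: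
  fixes x y :: "'c::comm_ring_1"
  assumes "ideal I (subring_of S)" "subring S ring_of_type_algebra"
    and "x \<in> S" "y \<in> S" "x - y \<in> I"
  shows "x ^ k - y ^ k \<in> I"
  using prod_diff_in_ideal[OF assms(1,2), of "{..<k}" "\<lambda>_. x" "\<lambda>_. y"] assms(3-) by simp

lemma eval_diff_in_ideal:
  fixes x y :: "nat \<Rightarrow> 'c::comm_ring_1"
  assumes I: "ideal I (subring_of S)" and S: "subring S ring_of_type_algebra"
    and p: "p \<in> mpolys S n"
    and x: "\<And>i. i < n \<Longrightarrow> x i \<in> S" and y: "\<And>i. i < n \<Longrightarrow> y i \<in> S"
    and xy: "\<And>i. i < n \<Longrightarrow> x i - y i \<in> I"
  shows "eval x p - eval y p \<in> I"
proof -
  have "i < n" if "m \<in> Poly_Mapping.keys p" "i \<in> Poly_Mapping.keys m" for m i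
    using mpolysD[OF p that(1)] that(2) by (auto simp: monomials_def)
  then show ?thesis
    unfolding eval_def sum_subtractf[symmetric] right_diff_distrib[symmetric]
    by (intro ideal_sum[OF I] ideal_mult[OF I] prod_diff_in_ideal[OF I S]
        power_diff_in_ideal[OF I S] subring_power[OF S] mpolysD_coeff[OF p subring_zero[OF S]]
        x y xy)
qed

text \<open>
  Modulo the ideal of the point \<open>c\<close> the variables become the coordinates of \<open>c\<close>. Since
  evaluation respects congruences, \<open>p = p(y)\<close> is congruent to \<open>p(c)\<close>.
\<close>

lemma diff_Const_eval_in_point_ideal:
  fixes p :: "'c::comm_ring_1 mpoly"
  assumes p: "p \<in> mpolys UNIV n"
  shows "p - Const (eval c p) \<in>
    genideal (mpoly_ring UNIV n) ((\<lambda>i. Var i - Const (c i)) ` {..<n})"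
  unfolding genideal_def
proof safe
  fix I :: "'c mpoly set"
  assume I: "ideal I (mpoly_ring UNIV n)" and gens: "(\<lambda>i. Var i - Const (c i)) ` {..<n} \<subseteq> I"
  have S: "subring (mpolys (UNIV :: 'c set) n) ring_of_type_algebra"
    by (rule subring_mpolys[OF subring_UNIV])
  have "map_coeffs Const p \<in> mpolys (mpolys UNIV n) n"
    using p by (rule map_coeffs_in_mpolys) (simp add: Const_in_mpolys)
  then have "eval Var (map_coeffs Const p) - eval (\<lambda>i. Const (c i)) (map_coeffs Const p) \<in> I"
    by (rule eval_diff_in_ideal[OF I S])
      (use gens in \<open>auto intro: Var_in_mpolys Const_in_mpolys\<close>)
  also have "eval (\<lambda>i. Const (c i)) (map_coeffs Const p) = Const (eval c p)"
    by (simp add: hom_eval[OF Const_hom subring_UNIV p])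
  finally show "p - Const (eval c p) \<in> I"
    by (simp add: eval_Var)
qed


section \<open>Leading monomials and Groebner bases\<close>

context
  fixes n :: nat and ord :: "mono rel"
  assumes ord: "monomial_ordering n ord"
begin

lemma lm_greatest:
  assumes "p \<noteq> 0" "Poly_Mapping.keys p \<subseteq> monomials n"
  shows "lm ord p \<in> Poly_Mapping.keys p" "\<And>m. m \<in> Poly_Mapping.keys p \<Longrightarrow> (m, lm ord p) \<in> ord"
proof -
  have lin: "linear_order_on (monomials n) ord"
    using ord by (simp add: monomial_ordering_def)
  then have refl: "refl_on (monomials n) ord" and tr: "trans ord" and anti: "antisym ord"
    and total: "total_on (monomials n) ord"
    using partial_order_onD by (auto simp: linear_order_on_def)
  have "\<exists>m\<in>M. \<forall>m'\<in>M. (m', m) \<in> ord"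
    if "finite M" "M \<noteq> {}" "M \<subseteq> monomials n" for M
    using that
  proof (induction rule: finite_ne_induct)
    case (singleton x)
    then show ?case using refl by (auto simp: refl_on_def)
  next
    case (insert x M)
    then obtain m where m: "m \<in> M" "\<forall>m'\<in>M. (m', m) \<in> ord" by auto
    have xx: "(x, x) \<in> ord"
      using refl insert.prems by (auto simp: refl_on_def)
    have "x \<in> monomials n" "m \<in> monomials n" "x \<noteq> m"
      using insert.prems insert.hyps m(1) by auto
    then consider "(x, m) \<in> ord" | "(m, x) \<in> ord"
      using total by (auto simp: total_on_def)
    then show ?case
    proof cases
      case 1
      then show ?thesis using m by auto
    next
      case 2
      then have "\<forall>m'\<in>M. (m', x) \<in> ord"
        using m(2) tr by (meson transD)
      then show ?thesis using xx by auto
    qed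
  qed
  moreover have "Poly_Mapping.keys p \<noteq> {}"
    using assms(1) by (metis empty_iff in_keys_iff lookup_zero poly_mapping_eqI)
  ultimately have "\<exists>m\<in>Poly_Mapping.keys p. \<forall>m'\<in>Poly_Mapping.keys p. (m', m) \<in> ord"
    using assms(2) by simp
  then have "\<exists>!m. m \<in> Poly_Mapping.keys p \<and> (\<forall>m'\<in>Poly_Mapping.keys p. (m', m) \<in> ord)"
    using anti by (auto dest: antisymD)
  from theI'[OF this] show "lm ord p \<in> Poly_Mapping.keys p"
    "\<And>m. m \<in> Poly_Mapping.keys p \<Longrightarrow> (m, lm ord p) \<in> ord"
    by (auto simp: lm_def)
qed

text \<open>
  The monomial \<open>1\<close> is the least one, so nothing else can occur below it.
\<close>

lemma keys_eq_0_if_lm_eq_0: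
  assumes "p \<noteq> 0" "Poly_Mapping.keys p \<subseteq> monomials n" "lm ord p = 0"
  shows "Poly_Mapping.keys p = {0}"
proof -
  have "m = 0" if "m \<in> Poly_Mapping.keys p" for m
  proof -
    have "(m, 0) \<in> ord" "(0, m) \<in> ord"
      using lm_greatest(2)[OF assms(1,2) that] assms that ord
      by (auto simp: monomial_ordering_def)
    moreover have "antisym ord"
      using ord by (simp add: monomial_ordering_def linear_order_on_def partial_order_on_def)
    ultimately show ?thesis by (auto dest: antisymD)
  qed
  then show ?thesis
    using lm_greatest(1)[OF assms(1,2)] assms(3) by auto
qed

end

lemma lm_cong_keys: "Poly_Mapping.keys p = Poly_Mapping.keys q \<Longrightarrow> lm ord p = lm ord q"
  by (simp add: lm_def)

text \<open>
  The polynomials all of whose monomials are divisible by some leading monomial from \<open>S\<close> form an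
  ideal, which contains the generators of the leading ideal and therefore all of it.
\<close>

lemma monomial_in_leading_idealD:
  fixes S :: "'l::field mpoly set"
  assumes m: "Poly_Mapping.single m 1 \<in> leading_ideal n ord S"
    and S: "S \<subseteq> mpolys UNIV n" and ord: "monomial_ordering n ord"
  shows "\<exists>h\<in>S - {0}. mono_divides (lm ord h) m"
proof -
  define J :: "'l mpoly set" where "J = {p \<in> mpolys UNIV n.
    \<forall>v\<in>Poly_Mapping.keys p. \<exists>h\<in>S - {0}. mono_divides (lm ord h) v}"
  have subring: "subring (mpolys (UNIV :: 'l set) n) ring_of_type_algebra"
    by (rule subring_mpolys[OF subring_UNIV])
  have multiple: "mono_divides u (w + v)" if "mono_divides u v" for u v w
    using that by (auto simp: mono_divides_def) (metis add.left_commute)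
  have "ideal J (mpoly_ring UNIV n)"
  proof (rule ideal_subring_ofI[OF subring])
    show "0 \<in> J"
      using subring_zero[OF subring] by (simp add: J_def)
    show "p + q \<in> J" if "p \<in> J" "q \<in> J" for p q
      using that keys_add[of p q] subring_add[OF subring, of p q] by (auto simp: J_def)
    show "s * p \<in> J" if "s \<in> mpolys UNIV n" "p \<in> J" for s p
      using that keys_mult[of s p] subring_mult[OF subring, of s p] multiple
      unfolding J_def by blast
  qed (auto simp: J_def)
  moreover have "(\<lambda>p. Poly_Mapping.single (lm ord p) 1) ` (S - {0}) \<subseteq> J"
  proof (rule image_subsetI)
    fix p assume "p \<in> S - {0}"
    then have p: "p \<in> S" "p \<noteq> 0" by auto
    then have "Poly_Mapping.keys p \<subseteq> monomials n"
      using S by (auto simp: mpolys_def)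
    from lm_greatest(1)[OF ord p(2) this] this have "lm ord p \<in> monomials n"
      by blast
    moreover have "mono_divides (lm ord p) (lm ord p)"
      by (auto simp: mono_divides_def intro: exI[of _ 0])
    ultimately show "Poly_Mapping.single (lm ord p) 1 \<in> J"
      using p by (auto simp: J_def mpolys_def)
  qed
  ultimately have "leading_ideal n ord S \<subseteq> J"
    by (auto simp: leading_ideal_def genideal_def)
  with m show ?thesis
    by (auto simp: J_def)
qed

lemma lm_divisible_by_groebner_basis:
  fixes E :: "'l::field mpoly set"
  assumes B: "groebner_basis n ord E B" and E: "E \<subseteq> mpolys UNIV n"
    and ord: "monomial_ordering n ord" and p: "p \<in> E" "p \<noteq> 0"
  shows "\<exists>h\<in>B - {0}. mono_divides (lm ord h) (lm ord p)"
proof (rule monomial_in_leading_idealD[OF _ _ ord])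
  have "Poly_Mapping.single (lm ord p) 1 \<in> leading_ideal n ord E"
    using p by (auto simp: leading_ideal_def genideal_def)
  then show "Poly_Mapping.single (lm ord p) 1 \<in> leading_ideal n ord B"
    using B by (simp add: groebner_basis_def)
  show "B \<subseteq> mpolys UNIV n"
    using B E by (auto simp: groebner_basis_def)
qed

text \<open>
  A nonzero constant is a unit, because the coefficients form a field.
\<close>

lemma const_in_proper_ideal_eq_0:
  fixes E :: "'l::field mpoly set"
  assumes E: "ideal E (mpoly_ring UNIV n)" "E \<noteq> mpolys UNIV n"
    and p: "p \<in> E" "Poly_Mapping.keys p \<subseteq> {0}"
  shows "p = 0"
proof (rule ccontr)
  assume "p \<noteq> 0"
  define c where "c = Poly_Mapping.lookup p 0"
  have "Poly_Mapping.lookup p m = Poly_Mapping.lookup (Const c) m" for m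
    using p(2) by (cases "m = 0") (auto simp: Const_def c_def lookup_single in_keys_iff)
  then have pc: "p = Const c"
    by (rule poly_mapping_eqI)
  with \<open>p \<noteq> 0\<close> have "c \<noteq> 0" by auto
  have "Const (1 / c) * p \<in> E"
    by (rule ideal_mult[OF E(1) _ p(1)]) (simp add: Const_in_mpolys)
  then have "1 \<in> E"
    using \<open>c \<noteq> 0\<close> by (simp add: pc Const_def mult_single)
  then have "mpolys UNIV n \<subseteq> E"
    using ideal_mult[OF E(1), of _ 1] by auto
  moreover have "E \<subseteq> mpolys UNIV n"
    using ideal.Icarr[OF E(1)] by auto
  ultimately show False
    using E(2) by simp
qed

text \<open>
  Uniqueness of normal forms, in the case where one of the two is a constant. If \<open>q - c\<close> were
  nonzero, its leading monomial would be divisible by a leading monomial of the Groebner basis. It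
  would either be \<open>1\<close>, whence \<open>q - c\<close> would be a nonzero constant in the proper ideal \<open>E\<close>, or
  occur in \<open>q\<close>, which has no such monomials.
\<close>

lemma standard_congruent_const:
  fixes E :: "'l::field mpoly set"
  assumes E: "ideal E (mpoly_ring UNIV n)" "E \<noteq> mpolys UNIV n"
    and ord: "monomial_ordering n ord" and B: "groebner_basis n ord E B"
    and q: "\<And>v h. v \<in> Poly_Mapping.keys q \<Longrightarrow> h \<in> B - {0} \<Longrightarrow> \<not> mono_divides (lm ord h) v"
    and c: "q - Const c \<in> E"
  shows "q = Const c"
proof (rule ccontr)
  assume "q \<noteq> Const c"
  define d where "d = q - Const c"
  have d: "d \<in> E" "d \<noteq> 0"
    using c \<open>q \<noteq> Const c\<close> by (simp_all add: d_def)
  have sub: "E \<subseteq> mpolys UNIV n"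
    using ideal.Icarr[OF E(1)] by auto
  then have keys: "Poly_Mapping.keys d \<subseteq> monomials n"
    using d(1) by (auto simp: mpolys_def)
  have "lm ord d \<noteq> 0"
  proof
    assume "lm ord d = 0"
    then have "Poly_Mapping.keys d \<subseteq> {0}"
      using keys_eq_0_if_lm_eq_0[OF ord d(2) keys] by simp
    then show False
      using const_in_proper_ideal_eq_0[OF E d(1)] d(2) by blast
  qed
  then have "lm ord d \<in> Poly_Mapping.keys q"
    using lm_greatest(1)[OF ord d(2) keys]
    by (auto simp: d_def in_keys_iff lookup_minus Const_def lookup_single)
  then show False
    using lm_divisible_by_groebner_basis[OF B sub ord d] q by blast
qed

section \<open>Reduction with lifted coefficients\<close>

text \<open>
  The step subtracts \<open>q y\<^sup>u h\<close>, and \<open>\<psi>\<close> maps this to a multiple of the element \<open>\<psi>(h)\<close> of \<open>E\<close>.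
\<close>

lemma reduction_step_preserves:
  fixes \<psi> :: "'c::comm_ring_1 mpoly \<Rightarrow> 'c"
  assumes psi: "\<psi> \<in> ring_hom (subring_of C) (subring_of D)"
    and C: "subring C ring_of_type_algebra"
    and E: "ideal E (mpoly_ring UNIV n)"
    and F: "F \<subseteq> mpolys C n" "map_coeffs \<psi> ` F \<subseteq> E"
    and step: "reduction_step ord C F p p'" and p: "p \<in> mpolys C n"
  shows "p' \<in> mpolys C n" "map_coeffs \<psi> p - map_coeffs \<psi> p' \<in> E"
proof -
  note subring = subring_mpolys[OF C, of n]
  from step obtain h q u where h: "h \<in> F" and q: "q \<in> C" and nz: "q * lc ord h \<noteq> 0"
    and cancel: "\<forall>w\<in>Poly_Mapping.keys (q * lc ord h).
           Poly_Mapping.lookup (q * lc ord h) w =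
           Poly_Mapping.lookup (Poly_Mapping.lookup p (u + lm ord h)) w"
    and p': "p' = p - Poly_Mapping.single u q * h"
    unfolding reduction_step_def by blast
  \<comment> \<open>The cancelled coefficient is nonzero, so the monomial \<open>u + lm ord h\<close> occurs in \<open>p\<close>.\<close>
  obtain w where "w \<in> Poly_Mapping.keys (q * lc ord h)"
    using nz by (metis in_keys_iff lookup_zero poly_mapping_eqI)
  with cancel have "Poly_Mapping.lookup p (u + lm ord h) \<noteq> 0"
    by (metis in_keys_iff lookup_zero)
  then have u: "u \<in> monomials n"
    using mpolysD[OF p, of "u + lm ord h"] monomials_add_left by (simp add: in_keys_iff)
  have "Poly_Mapping.single u q \<in> mpolys C n"
    using u q by (auto simp: mpolys_def)
  with h F(1) have prod: "Poly_Mapping.single u q * h \<in> mpolys C n"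
    by (auto intro: subring_mult[OF subring])
  with p show "p' \<in> mpolys C n"
    unfolding p' by (rule subring_minus[OF subring])
  have "map_coeffs \<psi> p - map_coeffs \<psi> p' = Poly_Mapping.single u (\<psi> q) * map_coeffs \<psi> h"
    using map_coeffs_minus[OF psi C p prod] map_coeffs_single_times[OF psi C q] h F(1)
    by (auto simp: p')
  also have "\<dots> \<in> E"
    using u h F(2) by (intro ideal_mult[OF E]) (auto simp: mpolys_def)
  finally show "map_coeffs \<psi> p - map_coeffs \<psi> p' \<in> E" .
qed

lemma reduction_preserves:
  fixes \<psi> :: "'c::comm_ring_1 mpoly \<Rightarrow> 'c"
  assumes psi: "\<psi> \<in> ring_hom (subring_of C) (subring_of D)"
    and C: "subring C ring_of_type_algebra"
    and E: "ideal E (mpoly_ring UNIV n)"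
    and F: "F \<subseteq> mpolys C n" "map_coeffs \<psi> ` F \<subseteq> E"
    and steps: "(reduction_step ord C F)\<^sup>*\<^sup>* p p'" and p: "p \<in> mpolys C n"
  shows "p' \<in> mpolys C n \<and> map_coeffs \<psi> p - map_coeffs \<psi> p' \<in> E"
  using steps
proof induction
  case base
  then show ?case using p ideal_zero[OF E] by simp
next
  case (step x y)
  with reduction_step_preserves[OF psi C E F step.hyps(2)] show ?case
    using ideal_add[OF E, of "map_coeffs \<psi> p - map_coeffs \<psi> x" "map_coeffs \<psi> x - map_coeffs \<psi> y"]
    by simp
qed

section \<open>Invariants and the Derksen ideal\<close>

lemma automorphism_hom:
  assumes "acts_by_automorphisms G \<phi>" "\<sigma> \<in> carrier G"
  shows "\<phi> \<sigma> \<in> ring_hom (subring_of UNIV) (subring_of UNIV)"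
  using assms by (auto simp: acts_by_automorphisms_def ring_iso_def ring_hom_def)

lemma diff_Const_invariant_in_derksen_ideal:
  assumes G: "acts_by_automorphisms G \<phi>" and K: "K \<subseteq> invariants G \<phi> UNIV"
    and f: "f \<in> mpolys K n" and inv: "eval a f \<in> invariants G \<phi> S"
  shows "f - Const (eval a f) \<in> derksen_ideal G \<phi> n a"
  unfolding derksen_ideal_def
proof
  fix \<sigma> assume \<sigma>: "\<sigma> \<in> carrier G"
  have f': "f \<in> mpolys UNIV n"
    using f mpolys_mono[of K UNIV n] by blast
  have "map_coeffs (\<phi> \<sigma>) f = f"
    using f K \<sigma> by (intro map_coeffs_ident) (auto simp: mpolys_def invariants_def)
  then have "\<phi> \<sigma> (eval a f) = eval (\<lambda>i. \<phi> \<sigma> (a i)) f"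
    using hom_eval[OF automorphism_hom[OF G \<sigma>] subring_UNIV f', of a] by simp
  moreover have "\<phi> \<sigma> (eval a f) = eval a f"
    using inv \<sigma> by (simp add: invariants_def)
  ultimately show "f - Const (eval a f) \<in>
      genideal (mpoly_ring UNIV n) ((\<lambda>i. Var i - Const (\<phi> \<sigma> (a i))) ` {..<n})"
    using diff_Const_eval_in_point_ideal[OF f', of "\<lambda>i. \<phi> \<sigma> (a i)"] by simp
qed

lemma eval_in_generated_subalgebra:
  assumes "f \<in> mpolys K n"
  shows "eval a f \<in> generated_subalgebra K (a ` {..<n})"
proof (rule eval_in_subring)
  show "subring (generated_subalgebra K (a ` {..<n})) ring_of_type_algebra"
    unfolding generated_subalgebra_def
    by (rule ring.generate_ring_is_subring[OF ring_from_type_algebra]) simp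
  show "f \<in> mpolys (generated_subalgebra K (a ` {..<n})) n"
    using assms mpolys_mono[of K "generated_subalgebra K (a ` {..<n})" n]
    by (auto simp: generated_subalgebra_def intro: generate_ring.incl)
qed (auto simp: generated_subalgebra_def intro: generate_ring.incl)

text \<open>
  Apply \<open>\<psi>\<close> to the expansion of \<open>p\<close> in its variables: the constants are fixed, and the
  variables become the \<open>\<psi>(t\<^sub>i)\<close>.
\<close>

lemma algebra_hom_eq_eval:
  assumes psi: "algebra_hom K r S \<psi>" and K: "subring K ring_of_type_algebra"
    and p: "p \<in> mpolys K r"
  shows "\<psi> p = eval (\<lambda>i. \<psi> (Var i)) p"
proof -
  have hom: "\<psi> \<in> ring_hom (mpoly_ring K r) (subring_of S)" and psi_K: "\<And>c. c \<in> K \<Longrightarrow> \<psi> (Const c) = c"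
    using psi by (auto simp: algebra_hom_def)
  note subring = subring_mpolys[OF K, of r]
  have p': "map_coeffs Const p \<in> mpolys (mpolys K r) r"
    using p by (rule map_coeffs_in_mpolys) (rule Const_in_mpolys)
  have "\<psi> p = \<psi> (eval Var (map_coeffs Const p))"
    by (simp add: eval_Var)
  also have "\<dots> = eval (\<lambda>i. \<psi> (Var i)) (map_coeffs \<psi> (map_coeffs Const p))"
    by (rule hom_eval[OF hom subring p']) (simp add: Var_in_mpolys subring_one[OF K])
  also have "map_coeffs \<psi> (map_coeffs Const p) = p"
    using p by (simp add: map_coeffs_map_coeffs hom_zero[OF hom subring])
      (rule map_coeffs_ident, auto simp: mpolys_def intro: psi_K)
  finally show ?thesis .
qed

theorem theorem1p9:
  fixes G :: "('g, 'h) monoid_scheme"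
    and \<phi> :: "'g \<Rightarrow> 'l::field \<Rightarrow> 'l"
    and K R A :: "'l set"
    and n r :: nat
    and a :: "nat \<Rightarrow> 'l"
    and E B :: "'l mpoly set"
    and ord :: "mono rel"
    and \<psi> :: "'l mpoly \<Rightarrow> 'l"
    and Bt :: "'l mpoly mpoly set"
    and f g0 :: "'l mpoly"
    and g :: "'l mpoly mpoly"
    and b :: 'l
  assumes "acts_by_automorphisms G \<phi>"
    and "subring K ring_of_type_algebra"
    and "K \<subseteq> invariants G \<phi> UNIV"
    and "R = generated_subalgebra K (a ` {..<n})"
    and "stable G \<phi> R"
    and "quot_is_everything R"
    and "extended_derksen_ideal G \<phi> n a E"
    and "monomial_ordering n ord"
    and "reduced_groebner_basis n ord E B"
    and "A = generated_subalgebra K {Poly_Mapping.lookup p m |p m. p \<in> B \<and> m \<in> Poly_Mapping.keys p}"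
    and "algebra_hom K r (invariants G \<phi> UNIV) \<psi>"
    and "A \<subseteq> \<psi> ` mpolys K r"
    and "coefficient_lift K r n \<psi> B Bt"
    and "f \<in> mpolys K n"
    and "b = eval a f"
    and "normal_form ord (mpolys K r) Bt (map_coeffs Const f) g"
    and "g0 = eval (\<lambda>_. 0) g"
  shows "(b \<in> invariants G \<phi> R \<longleftrightarrow> b = \<psi> g0) \<and>
    (b \<in> invariants G \<phi> R \<longrightarrow>
       g0 \<in> mpolys K r \<and>
       (\<forall>i<r. \<psi> (Var i) \<in> invariants G \<phi> UNIV) \<and>
       \<psi> g0 = b \<and> b = eval (\<lambda>i. \<psi> (Var i)) g0)"
proof -
  note G = assms(1) and K = assms(2) and K_inv = assms(3) and ord = assms(8)
  note hom_K = assms(11) and f = assms(14) and b = assms(15)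
  have E: "ideal E (mpoly_ring UNIV n)" "E \<noteq> mpolys UNIV n" "derksen_ideal G \<phi> n a \<subseteq> E"
    using assms(7) by (auto simp: extended_derksen_ideal_def)
  have B: "groebner_basis n ord E B"
    using assms(9) by (simp add: reduced_groebner_basis_def)
  have hom: "\<psi> \<in> ring_hom (mpoly_ring K r) (subring_of (invariants G \<phi> UNIV))"
    and psi_K: "\<And>c. c \<in> K \<Longrightarrow> \<psi> (Const c) = c"
    using hom_K by (auto simp: algebra_hom_def)
  note subring = subring_mpolys[OF K, of r]
  have psi_0: "\<psi> 0 = 0"
    by (rule hom_zero[OF hom subring])
  have Bt: "Bt \<subseteq> mpolys (mpolys K r) n" "map_coeffs \<psi> ` Bt = B"
    "\<And>h. h \<in> Bt \<Longrightarrow> Poly_Mapping.keys (map_coeffs \<psi> h) = Poly_Mapping.keys h"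
    using assms(13) by (auto simp: coefficient_lift_def)
  have steps: "(reduction_step ord (mpolys K r) Bt)\<^sup>*\<^sup>* (map_coeffs Const f) g"
    and g_reduced: "\<And>v h. v \<in> Poly_Mapping.keys g \<Longrightarrow> h \<in> Bt - {0} \<Longrightarrow> \<not> mono_divides (lm ord h) v"
    using assms(16) by (auto simp: normal_form_def)
  have psi_f: "map_coeffs \<psi> (map_coeffs Const f) = f"
    using f by (simp add: map_coeffs_map_coeffs psi_0)
      (rule map_coeffs_ident, auto simp: mpolys_def intro: psi_K)
  have "map_coeffs Const f \<in> mpolys (mpolys K r) n"
    using f by (rule map_coeffs_in_mpolys) (rule Const_in_mpolys)
  moreover have "map_coeffs \<psi> ` Bt \<subseteq> E"
    using B Bt(2) by (simp add: groebner_basis_def)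
  ultimately have g: "g \<in> mpolys (mpolys K r) n" and cong: "f - map_coeffs \<psi> g \<in> E"
    using reduction_preserves[OF hom subring E(1) Bt(1) _ steps] by (simp_all add: psi_f)
  have g0_lookup: "g0 = Poly_Mapping.lookup g 0"
    using assms(17) by (simp add: eval_zero_point)
  have g0: "g0 \<in> mpolys K r"
    unfolding g0_lookup using mpolysD_coeff[OF g subring_zero[OF subring]] .
  have standard: "\<not> mono_divides (lm ord h) v"
    if v: "v \<in> Poly_Mapping.keys (map_coeffs \<psi> g)" and h: "h \<in> B - {0}" for v h
  proof -
    obtain h' where h': "h' \<in> Bt" "h = map_coeffs \<psi> h'"
      using h Bt(2) by auto
    then have "lm ord h = lm ord h'" "h' \<noteq> 0"
      using h lm_cong_keys[OF Bt(3)[OF h'(1)]] map_eq_zero_iff[of \<psi> h'] by auto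
    then show ?thesis
      using g_reduced[of v h'] h'(1) v keys_map_coeffs[of \<psi> g] by auto
  qed
  have forward: "b = \<psi> g0" if inv: "b \<in> invariants G \<phi> R"
  proof -
    have "f - Const b \<in> E"
      using diff_Const_invariant_in_derksen_ideal[OF G K_inv f, of a R] inv b E(3) by auto
    then have "(f - Const b) + - (f - map_coeffs \<psi> g) \<in> E"
      using ideal_uminus[OF E(1) subring_mpolys[OF subring_UNIV] cong] ideal_add[OF E(1)] by blast
    then have "map_coeffs \<psi> g - Const b \<in> E"
      by simp
    from standard_congruent_const[OF E(1,2) ord B standard this]
    have "Poly_Mapping.lookup (map_coeffs \<psi> g) 0 = b"
      by (simp add: Const_def)
    then show ?thesis
      by (simp add: g0_lookup lookup_map_coeffs psi_0)
  qed
  have "b \<in> invariants G \<phi> R" if "b = \<psi> g0"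
    using hom_closed[OF hom subring g0] that eval_in_generated_subalgebra[OF f, of a]
    by (auto simp: invariants_def b assms(4))
  moreover have "\<psi> (Var i) \<in> invariants G \<phi> UNIV" if "i < r" for i
    using that by (intro hom_closed[OF hom subring] Var_in_mpolys subring_one[OF K])
  ultimately show ?thesis
    using forward g0 algebra_hom_eq_eval[OF hom_K K g0] by auto
qed

end
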